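(* Let $W_n$ ($n\ge 3$) be the wheel of order $n+1$. Then $strc(W_3)=1$, and $strc(W_n)=\lceil n/3\rceil+1$ for $n\ge 4$.
   Context: All graphs are finite and simple. The wheel $W_n$ is obtained from the cycle $C_n$ by adding a new vertex adjacent to every vertex of $C_n$. A total-coloured path (vertices and edges coloured) is total-rainbow if its edges and internal vertices have pairwise distinct colours. $strc(G)$ is the minimum number of colours in a total-colouring of $G$ in which any two vertices $u,v$ are joined by a total-rainbow $u$–$v$ geodesic (a $u$–$v$ path of length $d(u,v)$). *)

theory Defs
  imports Complex_Main "HOL-Library.Extended_Nat"
begin

record 'a ugraph =
  verts :: "'a set"
  edges :: "'a set set"

definition finite_simple_graph :: "'a ugraph \<Rightarrow> bool" where
  "finite_simple_graph G \<longleftrightarrow>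
     finite (verts G) \<and> (\<forall>e\<in>edges G. e \<subseteq> verts G \<and> card e = 2)"

text \<open>Paths are non-empty lists of distinct vertices.\<close>

definition path_edges :: "'a list \<Rightarrow> 'a set set" where
  "path_edges p = {{p ! i, p ! Suc i} | i. Suc i < length p}"

definition internal_verts :: "'a list \<Rightarrow> 'a set" where
  "internal_verts p = set (butlast (tl p))"

definition path_between :: "'a ugraph \<Rightarrow> 'a \<Rightarrow> 'a \<Rightarrow> 'a list \<Rightarrow> bool" where
  "path_between G u v p \<longleftrightarrow>
     p \<noteq> [] \<and> hd p = u \<and> last p = v \<and> distinct p \<and>
     set p \<subseteq> verts G \<and> path_edges p \<subseteq> edges G"

definition path_length :: "'a list \<Rightarrow> nat" where
  "path_length p = length p - 1"

definition graph_dist :: "'a ugraph \<Rightarrow> 'a \<Rightarrow> 'a \<Rightarrow> enat" where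
  "graph_dist G u v = (INF p\<in>{p. path_between G u v p}. enat (path_length p))"

definition geodesic :: "'a ugraph \<Rightarrow> 'a \<Rightarrow> 'a \<Rightarrow> 'a list \<Rightarrow> bool" where
  "geodesic G u v p \<longleftrightarrow>
     path_between G u v p \<and> enat (path_length p) = graph_dist G u v"

text \<open>A total-colouring is a function on the disjoint sum of vertices and edges; it need
  not be proper. Only its values on \<open>verts G <+> edges G\<close> matter.\<close>

definition total_rainbow :: "('a + 'a set \<Rightarrow> nat) \<Rightarrow> 'a list \<Rightarrow> bool" where
  "total_rainbow c p \<longleftrightarrow> inj_on c (internal_verts p <+> path_edges p)"

definition strongly_total_rainbow_connected ::
    "'a ugraph \<Rightarrow> ('a + 'a set \<Rightarrow> nat) \<Rightarrow> bool" where
  "strongly_total_rainbow_connected G c \<longleftrightarrow>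
     (\<forall>u\<in>verts G. \<forall>v\<in>verts G. u \<noteq> v \<longrightarrow> (\<exists>p. geodesic G u v p \<and> total_rainbow c p))"

text \<open>Meaningful for finite connected graphs. For a disconnected graph the infimum is over
  the empty set and is 0, which is not the value for any finite connected non-empty graph.\<close>

definition strc :: "'a ugraph \<Rightarrow> nat" where
  "strc G = Inf {card (c ` (verts G <+> edges G)) | c. strongly_total_rainbow_connected G c}"

text \<open>A simple graph only for \<open>n \<ge> 3\<close>.\<close>

definition cycle_graph :: "nat \<Rightarrow> nat ugraph" where
  "cycle_graph n = \<lparr>verts = {..<n}, edges = {{i, Suc i mod n} | i. i < n}\<rparr>"

text \<open>The new vertex is \<open>None\<close>.\<close>

definition add_universal_vertex :: "'a ugraph \<Rightarrow> 'a option ugraph" where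
  "add_universal_vertex G =
     \<lparr>verts = insert None (Some ` verts G),
      edges = (`) Some ` edges G \<union> {{None, Some v} | v. v \<in> verts G}\<rparr>"

definition wheel :: "nat \<Rightarrow> nat option ugraph" where
  "wheel n = add_universal_vertex (cycle_graph n)"

lemma finite_simple_graph_cycle:
  assumes "n \<ge> 3"
  shows "finite_simple_graph (cycle_graph n)"
proof -
  have "i \<noteq> Suc i mod n" if "i < n" for i
    using assms that by (cases "Suc i = n") auto
  then show ?thesis
    using assms by (auto simp: finite_simple_graph_def cycle_graph_def card_2_iff)
qed

lemma finite_simple_graph_wheel:
  assumes "n \<ge> 3"
  shows "finite_simple_graph (wheel n)"
  using finite_simple_graph_cycle[OF assms]
  by (auto simp: wheel_def finite_simple_graph_def add_universal_vertex_def card_image)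

lemma card_verts_wheel: "card (verts (wheel n)) = n + 1"
  by (simp add: wheel_def add_universal_vertex_def cycle_graph_def card_image)

end

theory Submission imports Defs begin

text \<open>Two rim vertices at cyclic distance at least 3 have only the geodesic through the hub.
  For \<open>n \<ge> 7\<close> this forces the hub colour to differ from every spoke colour, and a spoke colour to
  occur at most three times. Conversely, three consecutive rim vertices may share a spoke
  colour, since the two outer ones can be joined along the rim. For \<open>4 \<le> n \<le> 6\<close> the bound is 3,
  the number of edges and internal vertices of a path of length 2.\<close>

section \<open>Paths with one or two edges and their geodesics\<close>

lemma path_edges_2: "path_edges [u, v] = {{u, v}}"
  by (auto simp: path_edges_def)

lemma path_edges_3: "path_edges [u, w, v] = {{u, w}, {w, v}}"
proof -
  have "{i. Suc i < length [u, w, v]} = {0, 1}"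
    by auto
  moreover have "path_edges [u, w, v]
      = (\<lambda>i. {[u, w, v] ! i, [u, w, v] ! Suc i}) ` {i. Suc i < length [u, w, v]}"
    unfolding path_edges_def by blast
  ultimately show ?thesis
    by simp
qed

lemma total_rainbow_2: "total_rainbow c [u, v]"
  by (auto simp: total_rainbow_def internal_verts_def path_edges_2 inj_on_def)

lemma total_rainbow_3:
  assumes "u \<noteq> v"
  shows "total_rainbow c [u, w, v] \<longleftrightarrow>
    c (Inl w) \<noteq> c (Inr {u, w}) \<and> c (Inl w) \<noteq> c (Inr {w, v}) \<and> c (Inr {u, w}) \<noteq> c (Inr {w, v})"
proof -
  have "{w} <+> {{u, w}, {w, v}} = {Inl w, Inr {u, w}, Inr {w, v}}"
    by auto
  \<comment> \<open>Distinct ends give two distinct edges, so injectivity separates the edge colours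
    as well.\<close>
  moreover have "{u, w} \<noteq> {w, v}"
    using assms by (auto simp: doubleton_eq_iff)
  ultimately show ?thesis
    by (auto simp: total_rainbow_def internal_verts_def path_edges_3)
qed

lemma path_between_length_ge_1:
  assumes "path_between G u v p" "u \<noteq> v"
  shows "1 \<le> path_length p"
  using assms
  by (cases p rule: list.exhaust; cases "tl p") (auto simp: path_between_def path_length_def)

lemma path_between_length_ge_2:
  assumes "path_between G u v p" "u \<noteq> v" "{u, v} \<notin> edges G"
  shows "2 \<le> path_length p"
proof (rule ccontr)
  assume "\<not> 2 \<le> path_length p"
  with path_between_length_ge_1[OF assms(1,2)] have "length p = 2"
    by (simp add: path_length_def)
  then obtain a b where "p = [a, b]"
    by (auto simp: numeral_2_eq_2 length_Suc_conv)
  with assms show False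
    by (auto simp: path_between_def path_edges_2)
qed

lemma graph_dist_eqI:
  assumes "path_between G u v p" "\<And>q. path_between G u v q \<Longrightarrow> path_length p \<le> path_length q"
  shows "graph_dist G u v = enat (path_length p)"
  unfolding graph_dist_def using assms by (intro antisym INF_lower INF_greatest) auto

lemma geodesic_2:
  assumes "u \<in> verts G" "v \<in> verts G" "u \<noteq> v" "{u, v} \<in> edges G"
  shows "geodesic G u v [u, v]"
proof -
  have "path_between G u v [u, v]"
    using assms by (auto simp: path_between_def path_edges_2)
  moreover from this have "graph_dist G u v = enat (path_length [u, v])"
    using path_between_length_ge_1[OF _ assms(3)]
    by (intro graph_dist_eqI) (auto simp: path_length_def)
  ultimately show ?thesis
    by (simp add: geodesic_def)
qed

lemma path_between_3_iff:
  "path_between G u v [u, w, v] \<longleftrightarrow> u \<noteq> v \<and> u \<noteq> w \<and> w \<noteq> v \<and>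
     {u, v, w} \<subseteq> verts G \<and> {u, w} \<in> edges G \<and> {w, v} \<in> edges G"
  by (auto simp: path_between_def path_edges_3)

lemma graph_dist_eq_2:
  assumes "path_between G u v [u, w, v]" "{u, v} \<notin> edges G"
  shows "graph_dist G u v = enat 2"
proof -
  have "u \<noteq> v"
    using assms(1) by (simp add: path_between_3_iff)
  then have "graph_dist G u v = enat (path_length [u, w, v])"
    using assms path_between_length_ge_2[of G u v]
    by (intro graph_dist_eqI) (auto simp: path_length_def numeral_2_eq_2)
  then show ?thesis
    by (simp add: path_length_def)
qed

lemma geodesic_3:
  assumes "path_between G u v [u, w, v]" "{u, v} \<notin> edges G"
  shows "geodesic G u v [u, w, v]"
  using assms graph_dist_eq_2[OF assms] by (simp add: geodesic_def path_length_def)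

text \<open>The exhibited path through \<open>w\<close> fixes the distance at 2, so every geodesic
  has exactly three vertices. Its middle vertex may differ from \<open>w\<close>; the lower bounds
  examine what it can be.\<close>

lemma geodesic_3E:
  assumes "geodesic G u v p" "path_between G u v [u, w, v]" "{u, v} \<notin> edges G"
  obtains x where "p = [u, x, v]" "path_between G u v [u, x, v]"
proof -
  have p: "path_between G u v p" "path_length p = 2"
    using assms(1) graph_dist_eq_2[OF assms(2,3)] by (auto simp: geodesic_def)
  then have "length p = 3"
    by (simp add: path_length_def)
  then obtain a x b where "p = [a, x, b]"
    by (auto simp: numeral_3_eq_3 length_Suc_conv)
  with p(1) have "p = [u, x, v]"
    by (auto simp: path_between_def)
  with p(1) that show thesis
    by blast
qed

section \<open>Evaluating \<open>strc\<close>\<close>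

lemma strongly_total_rainbow_connectedE:
  assumes "strongly_total_rainbow_connected G c" "u \<in> verts G" "v \<in> verts G" "u \<noteq> v"
  obtains p where "geodesic G u v p" "total_rainbow c p"
  using assms unfolding strongly_total_rainbow_connected_def by blast

text \<open>The lower bound, applied to \<open>c\<close> itself, turns its upper bound into an
  equality. Hence \<open>k\<close> belongs to the set and is its minimum.\<close>

lemma strc_eqI:
  assumes "strongly_total_rainbow_connected G c"
    and "card (c ` (verts G <+> edges G)) \<le> k"
    and "\<And>c'. strongly_total_rainbow_connected G c' \<Longrightarrow> k \<le> card (c' ` (verts G <+> edges G))"
  shows "strc G = k"
proof -
  have "card (c ` (verts G <+> edges G)) = k"
    using assms by (intro antisym) auto
  with assms show ?thesis
    unfolding strc_def by (intro cInf_eq_minimum) blast+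
qed

lemma finite_total:
  assumes "finite_simple_graph G"
  shows "finite (verts G <+> edges G)"
proof -
  have "edges G \<subseteq> Pow (verts G)" "finite (verts G)"
    using assms by (auto simp: finite_simple_graph_def)
  then show ?thesis
    by (metis finite_Pow_iff finite_Plus finite_subset)
qed

section \<open>Adjacency in the wheel\<close>

lemma verts_wheel: "verts (wheel n) = insert None (Some ` {..<n})"
  by (simp add: wheel_def add_universal_vertex_def cycle_graph_def)

lemma edges_wheel:
  "edges (wheel n) = {{Some i, Some (Suc i mod n)} | i. i < n} \<union> {{None, Some i} | i. i < n}"
  by (auto simp: wheel_def add_universal_vertex_def cycle_graph_def image_def)

lemma spoke_in_wheel: "{None, Some i} \<in> edges (wheel n) \<longleftrightarrow> i < n"
  by (auto simp: edges_wheel doubleton_eq_iff)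

lemma rim_in_wheel:
  assumes "i < j" "j < n"
  shows "{Some i, Some j} \<in> edges (wheel n) \<longleftrightarrow> j = Suc i \<or> (i = 0 \<and> Suc j = n)"
proof
  assume "{Some i, Some j} \<in> edges (wheel n)"
  then obtain k where k: "k < n" "{i, j} = {k, Suc k mod n}"
    by (auto simp: edges_wheel doubleton_eq_iff)
  with assms show "j = Suc i \<or> (i = 0 \<and> Suc j = n)"
    by (cases "Suc k = n") (auto simp: doubleton_eq_iff)
next
  assume r: "j = Suc i \<or> (i = 0 \<and> Suc j = n)"
  \<comment> \<open>The witness is the end from which the cycle steps forward: \<open>i\<close> for
    an ordinary edge, \<open>j\<close> (the last rim vertex) for the edge wrapping round to
    0.\<close>
  have "\<exists>k<n. {Some i, Some j} = {Some k, Some (Suc k mod n)}"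
  proof (cases "j = Suc i")
    case True
    with assms show ?thesis by (intro exI[of _ i]) auto
  next
    case False
    with r assms show ?thesis by (intro exI[of _ j]) auto
  qed
  then show "{Some i, Some j} \<in> edges (wheel n)"
    by (auto simp: edges_wheel)
qed

lemma path_through_hub:
  assumes "i < n" "j < n" "i \<noteq> j"
  shows "path_between (wheel n) (Some i) (Some j) [Some i, None, Some j]"
  using assms spoke_in_wheel[of i n] spoke_in_wheel[of j n]
  by (auto simp: path_between_3_iff verts_wheel insert_commute)

section \<open>Lower bounds\<close>

lemma far_rim_vertices:
  assumes c: "strongly_total_rainbow_connected (wheel n) c"
    and ij: "i + 3 \<le> j" "j + 3 \<le> i + n" "j < n"
  shows "c (Inr {None, Some i}) \<noteq> c (Inr {None, Some j})"
    "c (Inl None) \<noteq> c (Inr {None, Some i})" "c (Inl None) \<noteq> c (Inr {None, Some j})"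
proof -
  have ne: "{Some i, Some j} \<notin> edges (wheel n)"
    using ij by (subst rim_in_wheel) auto
  obtain p where p: "geodesic (wheel n) (Some i) (Some j) p" "total_rainbow c p"
    by (rule strongly_total_rainbow_connectedE[OF c, of "Some i" "Some j"])
      (use ij in \<open>auto simp: verts_wheel\<close>)
  obtain x where x: "p = [Some i, x, Some j]" "path_between (wheel n) (Some i) (Some j) [Some i, x, Some j]"
    using p(1) path_through_hub[of i n j] ne ij by (elim geodesic_3E) auto
  \<comment> \<open>A middle vertex \<open>Some k\<close> would be a rim neighbour of both ends,
    placing them at cyclic distance at most 2, contrary to \<open>ij\<close>.\<close>
  have "x = None"
  proof (rule ccontr)
    assume "x \<noteq> None"
    with x(2) obtain k where k: "x = Some k" "k < n" "k \<noteq> i" "k \<noteq> j"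
      by (auto simp: path_between_3_iff verts_wheel)
    with x(2) have "{Some i, Some k} \<in> edges (wheel n)" "{Some k, Some j} \<in> edges (wheel n)"
      by (auto simp: path_between_3_iff)
    then show False
      using k ij rim_in_wheel[of i k n] rim_in_wheel[of k i n] rim_in_wheel[of k j n]
        rim_in_wheel[of j k n]
      by (cases "i < k"; cases "k < j") (auto simp: insert_commute)
  qed
  with p(2) x(1) ij total_rainbow_3[of "Some i" "Some j" c None]
  show "c (Inr {None, Some i}) \<noteq> c (Inr {None, Some j})"
    "c (Inl None) \<noteq> c (Inr {None, Some i})" "c (Inl None) \<noteq> c (Inr {None, Some j})"
    by (auto simp: insert_commute)
qed

text \<open>The assumption \<open>near\<close> says that a difference of two elements is at most 2
  or at least \<open>n - 2\<close>, that is, their cyclic distance is at most 2. Suppose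
  \<open>a < b < c < d\<close> lie in \<open>F\<close>. Then \<open>d - a\<close> is at least 3,
  hence at least \<open>n - 2\<close>. Removing a gap of at most 2 leaves at least
  \<open>n - 4\<close>, which is at least 3, so the remainder is again at least
  \<open>n - 2\<close>. Each case thus finds a consecutive gap of at least \<open>n - 2\<close>; the
  other two gaps add at least 2, contradicting \<open>d < n\<close>.\<close>

lemma card_pairwise_near_le_3:
  fixes F :: "nat set"
  assumes "F \<subseteq> {..<n}" "7 \<le> n"
    and near: "\<And>i j. i \<in> F \<Longrightarrow> j \<in> F \<Longrightarrow> i + 3 \<le> j \<Longrightarrow> i + n < j + 3"
  shows "card F \<le> 3"
proof (rule ccontr)
  assume "\<not> card F \<le> 3"
  define xs where "xs = sorted_list_of_set F"
  have fin: "finite F"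
    using assms(1) finite_subset by blast
  have len: "4 \<le> length xs"
    using \<open>\<not> card F \<le> 3\<close> by (simp add: xs_def)
  have in_F: "xs ! k \<in> F" if "k < 4" for k
    using that len fin by (metis nth_mem order_less_le_trans set_sorted_list_of_set xs_def)
  have less: "xs ! k < xs ! l" if "k < l" "l < 4" for k l
    using that len strict_sorted_list_of_set[of F] by (auto simp: xs_def sorted_wrt_iff_nth_less)
  obtain a b c d where F: "a \<in> F" "b \<in> F" "c \<in> F" "d \<in> F" and lt: "a < b" "b < c" "c < d"
    using in_F[of 0] in_F[of 1] in_F[of 2] in_F[of 3] less[of 0 1] less[of 1 2] less[of 2 3]
    by simp
  have "d < n"
    using F(4) assms(1) by auto
  have ad: "a + n < d + 3"
    using near F lt by simp
  show False
  proof (cases "a + 3 \<le> c")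
    case True
    then have ac: "a + n < c + 3"
      using near F by simp
    show False
    proof (cases "a + 3 \<le> b")
      case True
      then have "a + n < b + 3"
        using near F by simp
      then show False
        using lt \<open>d < n\<close> by linarith
    next
      case False
      with ac \<open>7 \<le> n\<close> have "b + n < c + 3"
        using near F by simp
      then show False
        using lt \<open>d < n\<close> by linarith
    qed
  next
    case False
    with ad \<open>7 \<le> n\<close> have "c + n < d + 3"
      using near F by simp
    then show False
      using lt \<open>d < n\<close> by linarith
  qed
qed

text \<open>For these \<open>n\<close> the rim vertices 0 and 2 are not adjacent. Whether the middle
  vertex \<open>x\<close> of their rainbow geodesic is the hub or a rim vertex, \<open>x\<close> and
  the two edges need three colours.\<close>

lemma wheel_ge_4_lower_bound:
  assumes n: "4 \<le> n" and c: "strongly_total_rainbow_connected (wheel n) c"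
  shows "3 \<le> card (c ` (verts (wheel n) <+> edges (wheel n)))"
proof -
  have ne: "{Some 0, Some 2} \<notin> edges (wheel n)"
    using n by (subst rim_in_wheel) auto
  obtain p where p: "geodesic (wheel n) (Some 0) (Some 2) p" "total_rainbow c p"
    by (rule strongly_total_rainbow_connectedE[OF c, of "Some 0" "Some 2"])
      (use n in \<open>auto simp: verts_wheel\<close>)
  obtain x where x: "p = [Some 0, x, Some 2]" "path_between (wheel n) (Some 0) (Some 2) [Some 0, x, Some 2]"
    using p(1) path_through_hub[of 0 n 2] ne n by (elim geodesic_3E) auto
  have "c ` {Inl x, Inr {Some 0, x}, Inr {x, Some 2}} \<subseteq> c ` (verts (wheel n) <+> edges (wheel n))"
    using x(2) by (intro image_mono) (auto simp: path_between_3_iff)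
  moreover have "card (c ` {Inl x, Inr {Some 0, x}, Inr {x, Some 2}}) = 3"
    using p(2) total_rainbow_3[of "Some 0" "Some 2" c x] by (simp add: x(1))
  moreover have "finite (verts (wheel n) <+> edges (wheel n))"
    using n by (intro finite_total finite_simple_graph_wheel) simp
  ultimately show ?thesis
    by (metis card_mono finite_imageI)
qed

lemma wheel_ge_7_lower_bound:
  assumes n: "7 \<le> n" and c: "strongly_total_rainbow_connected (wheel n) c"
  shows "(n + 2) div 3 + 1 \<le> card (c ` (verts (wheel n) <+> edges (wheel n)))"
proof -
  define s where "s i = c (Inr {None, Some i})" for i
  have fibre: "card {i \<in> {..<n}. s i = k} \<le> 3" for k
  proof (rule card_pairwise_near_le_3)
    fix i j
    assume "i \<in> {i \<in> {..<n}. s i = k}" "j \<in> {i \<in> {..<n}. s i = k}" "i + 3 \<le> j"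
    then show "i + n < j + 3"
      using far_rim_vertices(1)[OF c, of i j] by (fastforce simp: s_def)
  qed (use n in auto)
  \<comment> \<open>Every spoke needs a partner at cyclic distance at least 3: three steps ahead for
    \<open>i < 3\<close>, three steps back otherwise. Both choices avoid wrapping past 0.\<close>
  have hub: "c (Inl None) \<noteq> s i" if "i < n" for i
  proof (cases "i < 3")
    case True
    then show ?thesis
      using far_rim_vertices(2)[OF c, of i "i + 3"] n by (simp add: s_def)
  next
    case False
    then show ?thesis
      using far_rim_vertices(3)[OF c, of "i - 3" i] n that by (simp add: s_def)
  qed
  have "{..<n} = (\<Union>k\<in>s ` {..<n}. {i \<in> {..<n}. s i = k})"
    by auto
  then have "n = card (\<Union>k\<in>s ` {..<n}. {i \<in> {..<n}. s i = k})"
    by (metis card_lessThan)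
  also have "\<dots> \<le> (\<Sum>k\<in>s ` {..<n}. card {i \<in> {..<n}. s i = k})"
    by (intro card_UN_le) simp
  also have "\<dots> \<le> (\<Sum>k\<in>s ` {..<n}. 3)"
    by (intro sum_mono fibre)
  finally have "n \<le> 3 * card (s ` {..<n})"
    by simp
  \<comment> \<open>Since \<open>(n + 2) div 3\<close> is the least \<open>m\<close> with
    \<open>n <= 3 * m\<close>, it bounds the number of spoke colours from below; the hub colour lies
    outside them and adds one.\<close>
  then have "(n + 2) div 3 + 1 \<le> card (insert (c (Inl None)) (s ` {..<n}))"
    using hub by (subst card_insert_disjoint) auto
  also have "\<dots> \<le> card (c ` (verts (wheel n) <+> edges (wheel n)))"
  proof (rule card_mono)
    show "finite (c ` (verts (wheel n) <+> edges (wheel n)))"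
      using n by (intro finite_imageI finite_total finite_simple_graph_wheel) simp
    show "insert (c (Inl None)) (s ` {..<n}) \<subseteq> c ` (verts (wheel n) <+> edges (wheel n))"
      by (auto simp: s_def verts_wheel spoke_in_wheel)
  qed
  finally show ?thesis .
qed

section \<open>An optimal colouring for \<open>n\<close> at least 4\<close>

text \<open>The rim is cut into blocks \<open>3 * k\<close>, \<open>3 * k + 1\<close>,
  \<open>3 * k + 2\<close>, the last possibly shorter. All vertices get 0 and the spokes of block
  \<open>k\<close> get \<open>k + 1\<close>; \<open>THE\<close> extracts the rim end of a spoke. Rim
  edges reuse the spoke colours 1 and 2 so that the two edges inside a full block differ.\<close>

fun wheel_colouring :: "nat option + nat option set \<Rightarrow> nat" where
  "wheel_colouring (Inl _) = 0"
| "wheel_colouring (Inr e) =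
    (if None \<in> e then (THE i. Some i \<in> e) div 3 + 1
     else if \<exists>k. e = {Some (3 * k), Some (3 * k + 1)} then 1 else 2)"

lemma wheel_colouring_spoke:
  "wheel_colouring (Inr {None, Some i}) = i div 3 + 1" "wheel_colouring (Inr {Some i, None}) = i div 3 + 1"
  by auto

lemma wheel_colouring_rim_2: "wheel_colouring (Inr {Some (3 * k + 1), Some (3 * k + 2)}) = 2"
proof -
  \<comment> \<open>Neither \<open>3 * k + 1\<close> nor \<open>3 * k + 2\<close> is divisible by
    3.\<close>
  have "{Some (3 * k + 1), Some (3 * k + 2)} \<noteq> {Some (3 * l), Some (3 * l + 1)}" for l
    unfolding doubleton_eq_iff option.inject by presburger
  then show ?thesis
    by simp
qed

lemma card_wheel_colouring_le:
  assumes "4 \<le> n"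
  shows "card (wheel_colouring ` (verts (wheel n) <+> edges (wheel n))) \<le> (n + 2) div 3 + 1"
proof -
  \<comment> \<open>The last spoke colour \<open>(n - 1) div 3 + 1\<close> equals
    \<open>(n + 2) div 3\<close>, and \<open>4 <= n\<close> makes this at least 2, the largest rim
    colour.\<close>
  have "wheel_colouring ` (verts (wheel n) <+> edges (wheel n)) \<subseteq> {..(n + 2) div 3}"
    using assms by (auto simp: edges_wheel)
  then show ?thesis
    using card_mono[of "{..(n + 2) div 3}"] by simp
qed

text \<open>Adjacent vertices are joined by their edge. Rim vertices in different blocks go through
  the hub, whose colour 0 differs from the two distinct spoke colours. Non-adjacent vertices in one
  block are its first and last, joined along the rim with colours 1, 0, 2.\<close>

lemma wheel_colouring_rainbow_connected:
  "strongly_total_rainbow_connected (wheel n) wheel_colouring"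
  unfolding strongly_total_rainbow_connected_def
proof (intro ballI impI)
  let ?rainbow = "\<lambda>u v. \<exists>p. geodesic (wheel n) u v p \<and> total_rainbow wheel_colouring p"
  fix u v
  assume uv: "u \<in> verts (wheel n)" "v \<in> verts (wheel n)" "u \<noteq> v"
  show "?rainbow u v"
  proof (cases "{u, v} \<in> edges (wheel n)")
    case True
    then show ?thesis
      using geodesic_2[OF uv] total_rainbow_2[of wheel_colouring u v] by metis
  next
    case False
    then have "u \<noteq> None" "v \<noteq> None"
      using uv by (auto simp: verts_wheel spoke_in_wheel insert_commute)
    then obtain i j where ij: "u = Some i" "v = Some j" "i < n" "j < n" "i \<noteq> j"
      using uv by (auto simp: verts_wheel)
    show ?thesis
    proof (cases "i div 3 = j div 3")
      case False
      then have "total_rainbow wheel_colouring [Some i, None, Some j]"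
        using ij(5) by (simp add: total_rainbow_3 wheel_colouring_spoke del: wheel_colouring.simps(2))
      then show ?thesis
        using geodesic_3[OF path_through_hub[OF ij(3-5)]] \<open>{u, v} \<notin> _\<close> ij(1,2) by blast
    next
      case True
      define k where "k = i div 3"
      have "j \<noteq> Suc i" "i \<noteq> Suc j"
        using \<open>{u, v} \<notin> _\<close> ij rim_in_wheel[of i j n] rim_in_wheel[of j i n]
        by (auto simp: insert_commute)
      moreover have "3 * k \<le> i" "i < 3 * k + 3" "3 * k \<le> j" "j < 3 * k + 3"
        using True unfolding k_def by linarith+
      ultimately have cases: "i = 3 * k \<and> j = 3 * k + 2 \<or> i = 3 * k + 2 \<and> j = 3 * k"
        using ij(5) by linarith
      define a b d where abd: "a = Some (3 * k)" "b = Some (3 * k + 1)" "d = Some (3 * k + 2)"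
      \<comment> \<open>One of \<open>i\<close> and \<open>j\<close> is the last vertex of the
        block, so the block is complete and the middle vertex \<open>b\<close> exists.\<close>
      have "3 * k + 2 < n"
        using cases ij by auto
      then have "{a, b} \<in> edges (wheel n)" "{b, d} \<in> edges (wheel n)"
        unfolding abd by (simp_all add: rim_in_wheel)
      moreover have "wheel_colouring (Inr {a, b}) = 1" "wheel_colouring (Inr {b, d}) = 2"
        using wheel_colouring_rim_2[of k] by (auto simp: abd)
      moreover have "{a, b, d} \<subseteq> verts (wheel n)" "a \<noteq> b" "b \<noteq> d" "a \<noteq> d"
        using \<open>3 * k + 2 < n\<close> by (auto simp: abd verts_wheel)
      ultimately have
        "path_between (wheel n) a d [a, b, d]" "total_rainbow wheel_colouring [a, b, d]"
        "path_between (wheel n) d a [d, b, a]" "total_rainbow wheel_colouring [d, b, a]"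
        by (simp_all add: path_between_3_iff total_rainbow_3 insert_commute
            del: wheel_colouring.simps(2))
      moreover have "u = a \<and> v = d \<or> u = d \<and> v = a"
        using cases ij by (auto simp: abd)
      ultimately show ?thesis
        using geodesic_3 \<open>{u, v} \<notin> _\<close> by metis
    qed
  qed
qed

section \<open>The values of \<open>strc\<close>\<close>

text \<open>With a triangle as rim the wheel is complete, and a single edge is rainbow under any
  colouring, so a constant one suffices.\<close>

lemma strc_wheel_3: "strc (wheel 3) = 1"
proof (rule strc_eqI)
  have "{u, v} \<in> edges (wheel 3)" if "u \<in> verts (wheel 3)" "v \<in> verts (wheel 3)" "u \<noteq> v" for u v
  proof (cases "u = None \<or> v = None")
    case True
    then show ?thesis
      using that by (auto simp: verts_wheel spoke_in_wheel insert_commute)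
  next
    case False
    then obtain i j where "u = Some i" "v = Some j"
      by auto
    moreover from this have "i < 3" "j < 3" "i \<noteq> j"
      using that by (auto simp: verts_wheel)
    ultimately show ?thesis
      using rim_in_wheel[of i j 3] rim_in_wheel[of j i 3]
      by (cases "i < j") (auto simp: insert_commute)
  qed
  then show "strongly_total_rainbow_connected (wheel 3) (\<lambda>_. 0)"
    unfolding strongly_total_rainbow_connected_def
    using geodesic_2 total_rainbow_2 by metis
  show "card ((\<lambda>_. 0 :: nat) ` (verts (wheel 3) <+> edges (wheel 3))) \<le> 1"
    using card_mono[of "{0 :: nat}" "(\<lambda>_. 0) ` (verts (wheel 3) <+> edges (wheel 3))"] by auto
next
  fix c :: "nat option + nat option set \<Rightarrow> nat"
  have "finite (verts (wheel 3) <+> edges (wheel 3))"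
    by (intro finite_total finite_simple_graph_wheel) simp
  moreover have "Inl None \<in> verts (wheel 3) <+> edges (wheel 3)"
    by (simp add: verts_wheel InlI)
  ultimately show "1 \<le> card (c ` (verts (wheel 3) <+> edges (wheel 3)))"
    by (metis One_nat_def Suc_leI card_gt_0_iff empty_iff finite_imageI image_is_empty)
qed

lemma strc_wheel_ge_4:
  assumes "4 \<le> n"
  shows "strc (wheel n) = (n + 2) div 3 + 1"
proof (rule strc_eqI[OF wheel_colouring_rainbow_connected card_wheel_colouring_le[OF assms]])
  fix c
  assume c: "strongly_total_rainbow_connected (wheel n) c"
  show "(n + 2) div 3 + 1 \<le> card (c ` (verts (wheel n) <+> edges (wheel n)))"
  proof (cases "7 \<le> n")
    case True
    then show ?thesis
      using c by (rule wheel_ge_7_lower_bound)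
  next
    case False
    \<comment> \<open>For \<open>n\<close> at most 6 the quotient is at most 2.\<close>
    then have "(n + 2) div 3 + 1 \<le> 3"
      by simp
    then show ?thesis
      using wheel_ge_4_lower_bound[OF assms c] by linarith
  qed
qed

theorem theorem3p5:
  "strc (wheel 3) = 1 \<and> (\<forall>n\<ge>4. int (strc (wheel n)) = \<lceil>real n / 3\<rceil> + 1)"
proof -
  \<comment> \<open>With \<open>m = (n + 2) div 3\<close>, the number \<open>3 * m\<close> lies
    between \<open>n\<close> and \<open>n + 2\<close>, so \<open>m - 1 < n / 3 <= m\<close>.\<close>
  have "\<lceil>real n / 3\<rceil> = int ((n + 2) div 3)" for n
  proof (rule ceiling_unique)
    have "n \<le> 3 * ((n + 2) div 3)" "3 * ((n + 2) div 3) < n + 3"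
      by presburger+
    then show "real_of_int (int ((n + 2) div 3)) - 1 < real n / 3"
      "real n / 3 \<le> real_of_int (int ((n + 2) div 3))"
      by linarith+
  qed
  then show ?thesis
    by (simp add: strc_wheel_3 strc_wheel_ge_4)
qed

end
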